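(* Suppose that for some singular cardinal $\kappa$ of countable cofinality, the set $[\kappa]^\omega$ contains a locally countable family of cardinality $>\kappa$. Then there is a Corson compactum $X$ such that $c(X^\omega)=\kappa < d(X)$; in particular $X^\omega$ has no dense metrizable subspace.
   Context: $[\kappa]^\omega$ is the set of countable (infinite) subsets of $\kappa$. A family $\mathcal{F}$ of countable sets is locally countable if for every uncountable subfamily $\mathcal{G}\subseteq\mathcal{F}$ the set $\bigcup\mathcal{G}$ is uncountable. A compact Hausdorff space $X$ is a Corson compactum if for some cardinal $\lambda$ it is homeomorphic to a subspace of $\Sigma(\mathbb{R}^\lambda)=\{x \in \mathbb{R}^\lambda : |\{\alpha<\lambda: x(\alpha)\neq 0\}| \leq \aleph_0\}$. $c(Z)$ is the cellularity (supremum of cardinalities of families of pairwise disjoint non-empty open sets) and $d(Z)$ the density of $Z$. *)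

theory Defs
  imports "HOL-Analysis.Analysis"
begin

unbundle cardinal_syntax

text \<open>Cardinals are represented as cardinal orders (Card_order r) on some type;
  the cardinal kappa is the order type of r, its underlying set is Field r.\<close>

definition singular_countable_cof :: "'k rel \<Rightarrow> bool" where
  "singular_countable_cof r \<longleftrightarrow> Card_order r \<and> \<not> regularCard r \<and>
     (\<exists>K. K \<subseteq> Field r \<and> countable K \<and> cofinal K r)"

definition countable_subsets :: "'k set \<Rightarrow> 'k set set" where
  "countable_subsets A = {B. B \<subseteq> A \<and> countable B \<and> infinite B}"

definition locally_countable :: "'k set set \<Rightarrow> bool" where
  "locally_countable F \<longleftrightarrow> (\<forall>G \<subseteq> F. uncountable G \<longrightarrow> uncountable (\<Union>G))"

definition sigma_product :: "'l set \<Rightarrow> ('l \<Rightarrow> real) set" where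
  "sigma_product L = {x \<in> topspace (powertop_real L). countable {a \<in> L. x a \<noteq> 0}}"

definition corson_compactum_in :: "'l set \<Rightarrow> 'a topology \<Rightarrow> bool" where
  "corson_compactum_in L X \<longleftrightarrow> compact_space X \<and> Hausdorff_space X \<and>
     (\<exists>f. embedding_map X (powertop_real L) f \<and> f ` topspace X \<subseteq> sigma_product L)"

definition cellular_family :: "'a topology \<Rightarrow> 'a set set \<Rightarrow> bool" where
  "cellular_family Z U \<longleftrightarrow> (\<forall>V \<in> U. openin Z V \<and> V \<noteq> {}) \<and> pairwise disjnt U"

definition cellularity_eq :: "'a topology \<Rightarrow> 'k rel \<Rightarrow> bool" where
  "cellularity_eq Z r \<longleftrightarrow> (\<forall>U. cellular_family Z U \<longrightarrow> (card_of U) \<le>o r) \<and>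
     (\<forall>A \<subseteq> Field r. (card_of A) <o r \<longrightarrow> (\<exists>U. cellular_family Z U \<and> (card_of A) \<le>o (card_of U)))"

definition dense_in :: "'a topology \<Rightarrow> 'a set \<Rightarrow> bool" where
  "dense_in Z D \<longleftrightarrow> D \<subseteq> topspace Z \<and> Z closure_of D = topspace Z"

definition density_gt :: "'a topology \<Rightarrow> 'k rel \<Rightarrow> bool" where
  "density_gt Z r \<longleftrightarrow> (\<forall>D. dense_in Z D \<longrightarrow> r <o (card_of D))"

definition countable_power :: "'a topology \<Rightarrow> (nat \<Rightarrow> 'a) topology" where
  "countable_power X = product_topology (\<lambda>_. X) UNIV"

end

theory Submission
  imports Defs
begin

text \<open>Enumerate each member \<open>a\<close> of the family as a sequence \<open>f a\<close> in \<open>\<kappa>\<close> and call a subfamily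
  \<open>A\<close> thin if the tree of initial segments of its members is at most binary branching. The tree of
  a thin subfamily is countable, so \<open>A\<close> is countable by local countability; hence the indicators
  of thin subfamilies form a Corson compactum \<open>X\<close>. At most \<open>\<kappa>\<close> points of \<open>X\<close> have supports
  covering at most \<open>\<kappa>\<close> members of the family, so \<open>d(X) > \<kappa>\<close>. On the other hand, two finite thin
  sets with the same separated initial segments have a thin union, because the union only adds
  splittings into two. There are \<open>\<kappa>\<close> patterns of finitely many finite sequences in \<open>\<kappa>\<close>, so
  \<open>X\<^sup>\<omega>\<close> has a \<open>\<pi>\<close>-base that is a union of \<open>\<kappa>\<close> linked families. This bounds both the cellularity
  of \<open>X\<^sup>\<omega>\<close> and the density of any dense metrizable subspace by \<open>\<kappa>\<close>.\<close>

section \<open>Cardinality of sets of finite sequences\<close>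

lemma lists_ordLeq_infinite_Field:
  assumes r: "Card_order r" "infinite (Field r)" and A: "|A| \<le>o r"
  shows "|lists A| \<le>o r"
proof -
  have "|{xs. set xs \<subseteq> A \<and> length xs = n}| \<le>o r" for n
  proof (induction n)
    case 0
    have "{xs. set xs \<subseteq> A \<and> length xs = 0} = {[]}" by auto
    moreover have "Field r \<noteq> {}" using r(2) by auto
    ultimately show ?case
      using r(1) Card_order_singl_ordLeq by metis
  next
    case (Suc n)
    have "{xs. set xs \<subseteq> A \<and> length xs = Suc n} \<subseteq>
        (\<lambda>(x, xs). x # xs) ` (A \<times> {xs. set xs \<subseteq> A \<and> length xs = n})"
      by (auto simp: length_Suc_conv image_iff)
    then have "|{xs. set xs \<subseteq> A \<and> length xs = Suc n}| \<le>o |A \<times> {xs. set xs \<subseteq> A \<and> length xs = n}|"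
      by (meson card_of_image card_of_mono1 ordLeq_transitive)
    also have "|A \<times> {xs. set xs \<subseteq> A \<and> length xs = n}| \<le>o r"
      using card_of_Times_ordLeq_infinite_Field[OF r(2) A Suc.IH r(1)] .
    finally show ?case .
  qed
  moreover have "|UNIV :: nat set| \<le>o r"
    using r by (metis infinite_iff_card_of_nat card_of_Field_ordIso ordLeq_ordIso_trans)
  ultimately have "|\<Union>n. {xs. set xs \<subseteq> A \<and> length xs = n}| \<le>o r"
    by (intro card_of_UNION_ordLeq_infinite_Field r) auto
  moreover have "lists A = (\<Union>n. {xs. set xs \<subseteq> A \<and> length xs = n})" by auto
  ultimately show ?thesis by simp
qed

section \<open>Linked \<pi>-bases, cellularity and dense metrizable subspaces\<close>

text \<open>The fibres of \<open>t\<close> are the linked families. Only any two sets of a fibre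
  must meet: if each fibre had a point common to all its sets, these points would already form a
  dense set.\<close>

definition linked_pi_base :: "'z topology \<Rightarrow> 'i set \<Rightarrow> ('i \<Rightarrow> 'z set) \<Rightarrow> ('i \<Rightarrow> 'c) \<Rightarrow> bool" where
  "linked_pi_base Z I W t \<longleftrightarrow>
     (\<forall>i\<in>I. openin Z (W i) \<and> W i \<noteq> {}) \<and>
     (\<forall>V. openin Z V \<and> V \<noteq> {} \<longrightarrow> (\<exists>i\<in>I. W i \<subseteq> V)) \<and>
     (\<forall>i\<in>I. \<forall>j\<in>I. t i = t j \<longrightarrow> W i \<inter> W j \<noteq> {})"

text \<open>Choose a set of the \<pi>-base inside each member of \<open>U\<close>. Chosen sets with
  equal labels meet, and then so do the members containing them; hence the label determines the
  member.\<close>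

lemma linked_pi_base_cellular_family:
  assumes Z: "linked_pi_base Z I W t" and U: "cellular_family Z U"
  shows "|U| \<le>o |t ` I|"
proof -
  have "\<forall>V\<in>U. \<exists>i\<in>I. W i \<subseteq> V"
    using Z U unfolding linked_pi_base_def cellular_family_def by blast
  then obtain h where h: "\<And>V. V \<in> U \<Longrightarrow> h V \<in> I \<and> W (h V) \<subseteq> V"
    by metis
  have "inj_on (t \<circ> h) U"
  proof (rule inj_onI)
    fix V V' assume V: "V \<in> U" "V' \<in> U" "(t \<circ> h) V = (t \<circ> h) V'"
    then have "W (h V) \<inter> W (h V') \<noteq> {}"
      using Z h unfolding linked_pi_base_def by simp
    then have "\<not> disjnt V V'" using h V unfolding disjnt_def by blast
    then show "V = V'"
      using U V(1,2) unfolding cellular_family_def pairwise_def by blast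
  qed
  moreover have "(t \<circ> h) ` U \<subseteq> t ` I" using h by auto
  ultimately show ?thesis by (meson card_of_ordLeq)
qed

lemma dense_in_iff:
  "dense_in Z D \<longleftrightarrow> D \<subseteq> topspace Z \<and> (\<forall>V. openin Z V \<and> V \<noteq> {} \<longrightarrow> D \<inter> V \<noteq> {})"
  unfolding dense_in_def dense_intersects_open ..

text \<open>For each \<open>n\<close> and each label, pick one point of \<open>D\<close> in some set
  of that label whose trace on \<open>D\<close> is small. Near any \<open>x\<close> in
  \<open>D\<close> there is a small set; the point picked for its label lies in a possibly different
  small set, but the two sets meet, so the point is close to \<open>x\<close>.\<close>

lemma metrizable_dense_imp_small_dense:
  assumes Z: "linked_pi_base Z I W t" and r: "Card_order r" "infinite (Field r)"
    and tI: "|t ` I| \<le>o r"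
    and D: "dense_in Z D" and met: "metrizable_space (subtopology Z D)"
  shows "\<exists>E. dense_in Z E \<and> |E| \<le>o r"
proof -
  obtain M d where "Metric_space M d" and eq: "subtopology Z D = Metric_space.mtopology M d"
    using met unfolding metrizable_space_def by blast
  then interpret Metric_space M d by simp
  have DZ: "D \<subseteq> topspace Z" and Dmeet: "\<And>V. openin Z V \<Longrightarrow> V \<noteq> {} \<Longrightarrow> D \<inter> V \<noteq> {}"
    using D unfolding dense_in_iff by auto
  have "topspace (subtopology Z D) = M" using eq by simp
  then have M: "M = D" using DZ by auto
  define P where "P n c x \<longleftrightarrow> (\<exists>i\<in>I. t i = c \<and> x \<in> W i \<inter> D \<and>
      (\<forall>y\<in>W i \<inter> D. \<forall>z\<in>W i \<inter> D. d y z < 1 / real (Suc n)))" for n c x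
  define s where "s = (\<lambda>(n, c). SOME x. P n c x)"
  define E where "E = s ` {(n, c). c \<in> t ` I \<and> (\<exists>x. P n c x)}"
  have "|UNIV :: nat set| \<le>o r"
    using r by (metis infinite_iff_card_of_nat card_of_Field_ordIso ordLeq_ordIso_trans)
  then have "|(UNIV :: nat set) \<times> t ` I| \<le>o r"
    using card_of_Times_ordLeq_infinite_Field r tI by blast
  moreover have "|E| \<le>o |(UNIV :: nat set) \<times> t ` I|"
  proof -
    have "E \<subseteq> s ` ((UNIV :: nat set) \<times> t ` I)" unfolding E_def by auto
    then show ?thesis by (meson card_of_image card_of_mono1 ordLeq_transitive)
  qed
  ultimately have "|E| \<le>o r" by (rule ordLeq_transitive[rotated])
  moreover have "dense_in Z E"
    unfolding dense_in_iff
  proof (intro conjI allI impI)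
    have "s (n, c) \<in> D" if "P n c x" for n c x
      using someI[of "P n c", OF that] unfolding s_def P_def by auto
    then show "E \<subseteq> topspace Z" using DZ unfolding E_def by auto
    fix V assume V: "openin Z V \<and> V \<noteq> {}"
    then obtain x where x: "x \<in> D" "x \<in> V" using Dmeet by blast
    have "openin mtopology (V \<inter> D)" using V eq by (metis openin_subtopology_Int)
    then obtain e where e: "e > 0" "mball x e \<subseteq> V \<inter> D"
      using x unfolding openin_mtopology by blast
    obtain n where n: "1 / real (Suc n) < e / 2"
      using e(1) nat_approx_posE[of "e / 2"] by auto
    define q where "q = 1 / real (Suc n)"
    have q: "q > 0" "q < e / 2" using n unfolding q_def by auto
    \<comment> \<open>Radius \<open>q / 2\<close> keeps distances in the trace of \<open>W i\<close>
      below \<open>q\<close>, so a point is picked for the label \<open>t i\<close>; its distance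
      from \<open>x\<close> will be below \<open>q / 2 + q\<close>, hence below
      \<open>e\<close>.\<close>
    have "openin (subtopology Z D) (mball x (q / 2))" using eq by simp
    then obtain V' where V': "openin Z V'" "mball x (q / 2) = V' \<inter> D"
      unfolding openin_subtopology by blast
    have "x \<in> V'" using V' x q M by (metis IntE centre_in_mball_iff half_gt_zero)
    then obtain i where i: "i \<in> I" "W i \<subseteq> V' \<inter> V"
      using Z V V' x unfolding linked_pi_base_def
      by (metis (no_types, lifting) IntI empty_iff openin_Int)
    have Wball: "W i \<inter> D \<subseteq> mball x (q / 2)" using i V' by auto
    have diam: "d y z < q" if "y \<in> W i \<inter> D" "z \<in> W i \<inter> D" for y z
    proof -
      have "d x y < q / 2" "d x z < q / 2" "y \<in> M" "z \<in> M" "x \<in> M"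
        using that Wball by auto
      then show ?thesis using triangle[of y x z] commute[of x y] by simp
    qed
    obtain y0 where y0: "y0 \<in> D \<inter> W i"
      using Z i(1) Dmeet[of "W i"] unfolding linked_pi_base_def by blast
    have P: "P n (t i) y0"
      unfolding P_def q_def[symmetric] using i(1) diam y0 by blast
    have sE: "s (n, t i) \<in> E"
      unfolding E_def using P i(1) by (intro imageI) auto
    have "P n (t i) (s (n, t i))"
      unfolding s_def prod.case using P by (rule someI)
    then obtain j where j: "j \<in> I" "t j = t i" "s (n, t i) \<in> W j \<inter> D"
      "\<And>y z. y \<in> W j \<inter> D \<Longrightarrow> z \<in> W j \<inter> D \<Longrightarrow> d y z < q"
      unfolding P_def q_def by blast
    \<comment> \<open>The metric lives on \<open>D\<close> only, so the intermediate point must be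
      in \<open>D\<close>; density of \<open>D\<close> provides one in the non-empty open
      intersection.\<close>
    have "openin Z (W i \<inter> W j)" "W i \<inter> W j \<noteq> {}"
      using Z i j unfolding linked_pi_base_def by auto
    then obtain y where y: "y \<in> D" "y \<in> W i" "y \<in> W j" using Dmeet by blast
    have "d x y < q / 2" using Wball y by auto
    moreover have "d y (s (n, t i)) < q" using j y by simp
    moreover have "d x (s (n, t i)) \<le> d x y + d y (s (n, t i))"
      using x y j M by (intro triangle) auto
    ultimately have "d x (s (n, t i)) < e" using q by linarith
    then have "s (n, t i) \<in> mball x e"
      unfolding in_mball using x(1) j(3) unfolding M by blast
    then show "E \<inter> V \<noteq> {}" using e sE by auto
  qed
  ultimately show ?thesis by blast
qed

section \<open>Thin sets and their trees\<close>

text \<open>In the tree of initial segments the root has at most one successor and every other node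
  at most two. Each instance of the condition involves at most three members, which makes the
  property closed for indicators.\<close>

definition thin :: "('a \<Rightarrow> nat \<Rightarrow> 'c) \<Rightarrow> 'a set \<Rightarrow> bool" where
  "thin f A \<longleftrightarrow> (\<forall>a\<in>A. \<forall>b\<in>A. f a 0 = f b 0) \<and>
     (\<forall>a\<in>A. \<forall>b\<in>A. \<forall>c\<in>A. \<forall>m. (\<forall>k<m. f a k = f b k \<and> f a k = f c k) \<longrightarrow>
        f a m = f b m \<or> f a m = f c m \<or> f b m = f c m)"

lemma thin_mono: "thin f B \<Longrightarrow> A \<subseteq> B \<Longrightarrow> thin f A"
  unfolding thin_def by (meson subsetD)

lemma thin_singleton: "thin f {a}"
  unfolding thin_def by simp

lemma finite_if_no_three:
  assumes "\<And>x y z. x \<in> A \<Longrightarrow> y \<in> A \<Longrightarrow> z \<in> A \<Longrightarrow> x = y \<or> x = z \<or> y = z"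
  shows "finite A"
proof (cases "\<exists>x\<in>A. \<exists>y\<in>A. x \<noteq> y")
  case True
  then obtain x y where "x \<in> A" "y \<in> A" "x \<noteq> y" by blast
  then have "A \<subseteq> {x, y}" using assms by blast
  then show ?thesis using finite_subset by blast
next
  case False
  then have "A = {} \<or> (\<exists>x. A = {x})" by blast
  then show ?thesis by auto
qed

text \<open>Each level of the tree is finite, since each node of the previous level has only
  finitely many successors. All entries thus occur in countably many finite lists.\<close>

lemma thin_countable_range:
  assumes "thin f A"
  shows "countable (\<Union>a\<in>A. range (f a))"
proof -
  have fin: "finite ((\<lambda>a. map (f a) [0..<m]) ` A)" for m
  proof (induction m)
    case 0
    have "(\<lambda>a. map (f a) [0..<0]) ` A \<subseteq> {[]}" by auto
    then show ?case using finite_subset by blast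
  next
    case (Suc m)
    let ?L = "(\<lambda>a. map (f a) [0..<m]) ` A"
    let ?S = "\<lambda>u. (\<lambda>a. f a m) ` {a \<in> A. map (f a) [0..<m] = u}"
    have "finite (?S u)" for u
    proof (rule finite_if_no_three)
      fix x y z assume "x \<in> ?S u" "y \<in> ?S u" "z \<in> ?S u"
      then obtain a b c where abc: "a \<in> A" "b \<in> A" "c \<in> A" "x = f a m" "y = f b m" "z = f c m"
        and eq: "map (f a) [0..<m] = u" "map (f b) [0..<m] = u" "map (f c) [0..<m] = u"
        by blast
      have "\<forall>k<m. f a k = f b k \<and> f a k = f c k"
        using eq by (metis add_0 atLeastLessThan_iff map_eq_conv set_upt zero_le)
      then show "x = y \<or> x = z \<or> y = z"
        using assms abc unfolding thin_def by meson
    qed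
    then have "finite (\<Union>u\<in>?L. (\<lambda>v. u @ [v]) ` ?S u)"
      by (intro finite_UN_I[OF Suc] finite_imageI[of "?S _"])
    moreover have "(\<lambda>a. map (f a) [0..<Suc m]) ` A \<subseteq> (\<Union>u\<in>?L. (\<lambda>v. u @ [v]) ` ?S u)"
      by auto
    ultimately show ?case using finite_subset by blast
  qed
  have "(\<Union>a\<in>A. range (f a)) \<subseteq> (\<Union>m. \<Union>u\<in>(\<lambda>a. map (f a) [0..<m]) ` A. set u)"
  proof (clarsimp)
    fix a k assume "a \<in> A"
    then show "\<exists>m. \<exists>b\<in>A. f a k \<in> f b ` {0..<m}"
      by (intro exI[of _ "Suc k"] bexI[of _ a]) auto
  qed
  moreover have "countable (\<Union>m. \<Union>u\<in>(\<lambda>a. map (f a) [0..<m]) ` A. set u)"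
    by (intro countable_UN countable_finite[OF fin]) auto
  ultimately show ?thesis using countable_subset by blast
qed

text \<open>A branching at a level below \<open>m\<close> is already a branching of \<open>P\<close>, and a branching at
  a level from \<open>m\<close> on is between one branch of \<open>P\<close> and one branch of \<open>Q\<close>.\<close>

lemma thin_Un:
  assumes P: "thin f P" and Q: "thin f Q" and m: "m > 0"
    and PQ: "\<And>a. a \<in> P \<Longrightarrow> \<exists>b\<in>Q. \<forall>k<m. f a k = f b k"
    and QP: "\<And>b. b \<in> Q \<Longrightarrow> \<exists>a\<in>P. \<forall>k<m. f b k = f a k"
    and sepP: "\<And>a b. a \<in> P \<Longrightarrow> b \<in> P \<Longrightarrow> \<forall>k<m. f a k = f b k \<Longrightarrow> a = b"
    and sepQ: "\<And>a b. a \<in> Q \<Longrightarrow> b \<in> Q \<Longrightarrow> \<forall>k<m. f a k = f b k \<Longrightarrow> a = b"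
  shows "thin f (P \<union> Q)"
proof -
  have "\<forall>a\<in>P \<union> Q. \<exists>b\<in>P. \<forall>k<m. f a k = f b k" using QP by blast
  then obtain h where h: "\<And>a. a \<in> P \<union> Q \<Longrightarrow> h a \<in> P \<and> (\<forall>k<m. f a k = f (h a) k)"
    by metis
  have "f a 0 = f b 0" if "a \<in> P \<union> Q" "b \<in> P \<union> Q" for a b
    using h[OF that(1)] h[OF that(2)] P m unfolding thin_def by metis
  moreover have "f a l = f b l \<or> f a l = f c l \<or> f b l = f c l"
    if abc: "a \<in> P \<union> Q" "b \<in> P \<union> Q" "c \<in> P \<union> Q"
      and l: "\<forall>k<l. f a k = f b k \<and> f a k = f c k" for a b c l
  proof (cases "l < m")
    case True
    have "\<forall>k<l. f (h a) k = f (h b) k \<and> f (h a) k = f (h c) k"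
      using h[OF abc(1)] h[OF abc(2)] h[OF abc(3)] l True by (metis order.strict_trans)
    then have "f (h a) l = f (h b) l \<or> f (h a) l = f (h c) l \<or> f (h b) l = f (h c) l"
      using P h abc unfolding thin_def by meson
    then show ?thesis using h[OF abc(1)] h[OF abc(2)] h[OF abc(3)] True by metis
  next
    case False
    then have "\<forall>k<m. f a k = f b k" "\<forall>k<m. f a k = f c k" "\<forall>k<m. f b k = f c k"
      using l by (metis not_less order.strict_trans2)+
    then have "a = b \<or> a = c \<or> b = c" using abc sepP sepQ by (metis UnE)
    then show ?thesis by auto
  qed
  ultimately show ?thesis unfolding thin_def by blast
qed

lemma finite_separating_level:
  fixes f :: "'a \<Rightarrow> nat \<Rightarrow> 'c"
  assumes "finite A" "inj_on f A"
  shows "\<exists>m>0. \<forall>a\<in>A. \<forall>b\<in>A. (\<forall>k<m. f a k = f b k) \<longrightarrow> a = b"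
proof -
  have "\<exists>l. f a l \<noteq> f b l" if "a \<in> A" "b \<in> A" "a \<noteq> b" for a b
    using assms(2) that by (metis ext inj_onD)
  then obtain l where l: "\<And>a b. a \<in> A \<Longrightarrow> b \<in> A \<Longrightarrow> a \<noteq> b \<Longrightarrow> f a (l a b) \<noteq> f b (l a b)"
    by metis
  \<comment> \<open>The successor makes \<open>m\<close> exceed every chosen difference position and
    keeps it positive even if \<open>A\<close> is empty, where \<open>Max\<close> is unspecified.
    Diagonal pairs contribute arbitrary values, which can only raise \<open>m\<close>.\<close>
  define m where "m = Suc (Max ((\<lambda>(a, b). l a b) ` (A \<times> A)))"
  have "l a b < m" if "a \<in> A" "b \<in> A" for a b
    unfolding m_def less_Suc_eq_le using assms(1) that by (intro Max_ge) auto
  then have "\<forall>a\<in>A. \<forall>b\<in>A. (\<forall>k<m. f a k = f b k) \<longrightarrow> a = b" using l by blast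
  then show ?thesis unfolding m_def by blast
qed

section \<open>The compact space of indicators of thin sets\<close>

definition thin_indicators :: "'a set \<Rightarrow> ('a \<Rightarrow> nat \<Rightarrow> 'c) \<Rightarrow> ('a \<Rightarrow> real) set" where
  "thin_indicators F f =
     {x. (\<forall>a. x a = 0 \<or> x a = 1) \<and> {a. x a \<noteq> 0} \<subseteq> F \<and> thin f {a. x a \<noteq> 0}}"

lemma thin_indicators_of_set:
  assumes "A \<subseteq> F" "thin f A"
  shows "(\<lambda>a. if a \<in> A then 1 else 0) \<in> thin_indicators F f"
  using assms unfolding thin_indicators_def by simp

lemma closed_thin_indicators: "closed (thin_indicators F f)"
proof -
  \<comment> \<open>Thinness becomes a family of requirements that one of two or three given
    coordinates vanish; their premises do not mention \<open>x\<close>, so each defines a closed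
    set.\<close>
  have "thin_indicators F f = {x. (\<forall>a. x a = 0 \<or> x a = 1) \<and> (\<forall>a. a \<notin> F \<longrightarrow> x a = 0) \<and>
     (\<forall>a b. f a 0 \<noteq> f b 0 \<longrightarrow> x a = 0 \<or> x b = 0) \<and>
     (\<forall>a b c m. (\<forall>k<m. f a k = f b k \<and> f a k = f c k) \<and>
        f a m \<noteq> f b m \<and> f a m \<noteq> f c m \<and> f b m \<noteq> f c m \<longrightarrow> x a = 0 \<or> x b = 0 \<or> x c = 0)}"
    unfolding thin_indicators_def thin_def by (rule Collect_cong) blast
  also have "closed \<dots>"
    by (intro closed_Collect_conj closed_Collect_all closed_Collect_imp closed_Collect_disj
        closed_Collect_eq open_Collect_const continuous_on_const) auto
  finally show ?thesis .
qed

lemma compact_thin_indicators: "compact (thin_indicators F f)"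
proof -
  have "compactin (product_topology (\<lambda>_::'a. euclideanreal) UNIV) (PiE UNIV (\<lambda>_. {0, 1}))"
    unfolding compactin_PiE by simp
  then have "compact (PiE UNIV (\<lambda>_::'a. {0, 1::real}))"
    unfolding euclidean_product_topology by simp
  moreover have "thin_indicators F f \<subseteq> PiE UNIV (\<lambda>_. {0, 1})"
    unfolding thin_indicators_def by auto
  ultimately show ?thesis
    using closed_Int_compact[OF closed_thin_indicators] by (metis inf.absorb_iff1)
qed

lemma open_fun_contains_finite_agreement:
  fixes V :: "('a \<Rightarrow> real) set"
  assumes "open V" "x \<in> V"
  shows "\<exists>A. finite A \<and> (\<forall>y. (\<forall>a\<in>A. y a = x a) \<longrightarrow> y \<in> V)"
proof -
  have "openin (product_topology (\<lambda>_::'a. euclideanreal) UNIV) V"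
    using assms(1) unfolding euclidean_product_topology by simp
  from product_topology_open_contains_basis[OF this assms(2)]
  obtain U where U: "x \<in> (\<Pi>\<^sub>E i\<in>UNIV. U i)" "finite {i. U i \<noteq> UNIV}" "(\<Pi>\<^sub>E i\<in>UNIV. U i) \<subseteq> V"
    by auto
  have "y \<in> V" if "\<forall>a\<in>{i. U i \<noteq> UNIV}. y a = x a" for y
  proof -
    have "y a \<in> U a" for a using that U(1) by (cases "U a = UNIV") auto
    then show ?thesis using U(3) by auto
  qed
  then show ?thesis using U(2) by blast
qed

text \<open>The first entry \<open>f a 0\<close> is a free label, constant on thin sets: it makes the cellularity at least \<open>\<kappa>\<close> without
  any assumption on the branching of the family itself.\<close>

locale coded_family =
  fixes r :: "'k rel" and F :: "'a set" and f :: "'a \<Rightarrow> nat \<Rightarrow> 'k"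
  assumes card: "Card_order r" and inf: "infinite (Field r)"
    and large: "r <o |F|"
    and inj: "inj_on f F"
    and local_countable: "\<And>A. A \<subseteq> F \<Longrightarrow> countable (\<Union>a\<in>A. range (f a)) \<Longrightarrow> countable A"
    and entries: "\<And>a n. a \<in> F \<Longrightarrow> f a n \<in> Field r"
    and labels: "(\<lambda>a. f a 0) ` F = Field r"
begin

section \<open>The Corson compactum and its density\<close>

abbreviation K :: "('a \<Rightarrow> real) set" where "K \<equiv> thin_indicators F f"

abbreviation X :: "('a \<Rightarrow> real) topology" where "X \<equiv> top_of_set K"

text \<open>This puts \<open>K\<close> inside the \<Sigma>-product: a thin support involves only
  countably many entries, and local countability then bounds the support itself.\<close>

lemma support_countable: "x \<in> K \<Longrightarrow> countable {a. x a \<noteq> 0}"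
  by (rule local_countable[OF _ thin_countable_range]) (simp_all add: thin_indicators_def)

lemma corson: "corson_compactum_in (UNIV :: 'a set) X"
  unfolding corson_compactum_in_def
proof (intro conjI exI[of _ id])
  show "compact_space X" using compact_thin_indicators[of F f] by (simp add: compact_space_subtopology)
  show "Hausdorff_space X"
    unfolding euclidean_product_topology[symmetric]
    by (intro Hausdorff_space_subtopology) (simp add: Hausdorff_space_product_topology)
  show "embedding_map X (powertop_real UNIV) id"
    unfolding euclidean_product_topology by (simp add: embedding_map_def homeomorphic_map_id)
  show "id ` topspace X \<subseteq> sigma_product UNIV"
    using support_countable unfolding sigma_product_def by auto
qed

lemma nat_le: "|UNIV :: nat set| \<le>o r"
  using card inf by (metis infinite_iff_card_of_nat card_of_Field_ordIso ordLeq_ordIso_trans)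

lemma countable_le:
  assumes "countable A"
  shows "|A| \<le>o r"
proof -
  have "|A| \<le>o |UNIV :: nat set|"
    using assms card_of_ordLeq[of A "UNIV :: nat set"] unfolding countable_def by simp
  then show ?thesis using nat_le by (rule ordLeq_transitive)
qed

text \<open>Singletons are thin, so for each \<open>a\<close> in \<open>F\<close> the points of
  \<open>K\<close> non-zero at \<open>a\<close> form a non-empty open set. The supports of a dense
  set therefore cover \<open>F\<close>, whereas at most \<kappa> countable supports cover at most
  \<kappa> elements.\<close>

lemma dense_not_small:
  assumes "dense_in X D"
  shows "\<not> |D| \<le>o r"
proof
  assume D: "|D| \<le>o r"
  have "F \<subseteq> (\<Union>x\<in>D. {a. x a \<noteq> 0})"
  proof
    fix a assume a: "a \<in> F"
    have "open {x :: 'a \<Rightarrow> real. x a \<noteq> 0}"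
      by (intro open_Collect_neq) auto
    then have "openin X (K \<inter> {x. x a \<noteq> 0})" by auto
    moreover have "(\<lambda>b. if b \<in> {a} then 1 else 0) \<in> K \<inter> {x. x a \<noteq> 0}"
      using thin_indicators_of_set[of "{a}" F f] thin_singleton[of f a] a by simp
    ultimately show "a \<in> (\<Union>x\<in>D. {a. x a \<noteq> 0})"
      using assms unfolding dense_in_iff by fastforce
  qed
  moreover have "|\<Union>x\<in>D. {a. x a \<noteq> 0}| \<le>o r"
  proof (intro card_of_UNION_ordLeq_infinite_Field inf card D ballI countable_le)
    fix x assume "x \<in> D"
    then show "countable {a. x a \<noteq> 0}" using assms support_countable unfolding dense_in_def by auto
  qed
  ultimately have "|F| \<le>o r" by (meson card_of_mono1 ordLeq_transitive)
  then show False using large not_ordLess_ordLeq by blast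
qed

lemma density: "density_gt X r"
  unfolding density_gt_def
proof (intro allI impI)
  fix D assume "dense_in X D"
  then have "\<not> |D| \<le>o r" by (rule dense_not_small)
  then show "r <o |D|"
    using card by (meson card_of_Card_order card_order_on_well_order_on not_ordLess_iff_ordLeq)
qed

section \<open>The countable power and a disjoint family of size \<kappa>\<close>

abbreviation Z :: "(nat \<Rightarrow> 'a \<Rightarrow> real) topology" where "Z \<equiv> countable_power X"

lemma topspace_Z: "topspace Z = {x. \<forall>i. x i \<in> K}"
  unfolding countable_power_def by auto

lemma Z_value: "x \<in> topspace Z \<Longrightarrow> x i a = 0 \<or> x i a = 1"
  by (simp add: topspace_Z) (simp add: thin_indicators_def)

lemma openin_coordinate:
  assumes "open T"
  shows "openin Z {x \<in> topspace Z. x i a \<in> T}"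
proof -
  have "continuous_map Z X (\<lambda>x. x i)"
    unfolding countable_power_def by (rule continuous_map_product_projection) simp
  moreover have "continuous_map X euclideanreal (\<lambda>y. y a)"
    by (simp add: continuous_on_subset[OF continuous_on_product_coordinates])
  ultimately have "continuous_map Z euclideanreal ((\<lambda>y. y a) \<circ> (\<lambda>x. x i))"
    by (rule continuous_map_compose)
  from openin_continuous_map_preimage[OF this, of T] show ?thesis using assms by simp
qed

text \<open>Pick a member of \<open>F\<close> for each label and ask the factor \<open>0\<close> to
  be non-zero there. Two such conditions are incompatible for distinct labels, because a thin
  support has a single label.\<close>

lemma cellular_lower: "\<exists>U. cellular_family Z U \<and> |Field r| \<le>o |U|"
proof -
  have "\<forall>k\<in>Field r. \<exists>a. a \<in> F \<and> f a 0 = k" by (auto simp flip: labels)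
  from bchoice[OF this] obtain h where h: "\<And>k. k \<in> Field r \<Longrightarrow> h k \<in> F \<and> f (h k) 0 = k"
    by auto
  define V where "V k = {x \<in> topspace Z. x 0 (h k) \<in> - {0}}" for k
  have ne: "V k \<noteq> {}" if "k \<in> Field r" for k
  proof -
    have "(\<lambda>b. if b \<in> {h k} then 1 else 0) \<in> K"
      using h[OF that] by (intro thin_indicators_of_set thin_singleton) auto
    then have "(\<lambda>_ b. if b \<in> {h k} then 1 else 0) \<in> V k"
      unfolding V_def topspace_Z by simp
    then show ?thesis by blast
  qed
  have disj: "V k \<inter> V l = {}" if "k \<in> Field r" "l \<in> Field r" "k \<noteq> l" for k l
  proof (rule ccontr)
    assume "V k \<inter> V l \<noteq> {}"
    then obtain x where "x \<in> V k" "x \<in> V l" by blast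
    then have "x 0 \<in> K" "x 0 (h k) \<noteq> 0" "x 0 (h l) \<noteq> 0"
      by (simp_all add: V_def topspace_Z)
    then have "thin f {a. x 0 a \<noteq> 0}" "h k \<in> {a. x 0 a \<noteq> 0}" "h l \<in> {a. x 0 a \<noteq> 0}"
      by (simp_all add: thin_indicators_def)
    then have "f (h k) 0 = f (h l) 0" unfolding thin_def by blast
    then show False using h that by metis
  qed
  have "openin Z (V k)" for k unfolding V_def by (rule openin_coordinate) auto
  then have "cellular_family Z (V ` Field r)"
    unfolding cellular_family_def pairwise_def disjnt_def using ne disj by blast
  moreover have "inj_on V (Field r)"
    using ne disj by (metis inf.idem inj_onI)
  then have "|Field r| \<le>o |V ` Field r|" using card_of_ordLeq by blast
  ultimately show ?thesis by blast
qed

text \<open>A condition is a list of triples \<open>(i, a, b)\<close>, prescribing the value \<open>b\<close> for coordinate \<open>a\<close> of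
  the \<open>i\<close>-th factor, with a level \<open>m\<close> below which the sequences \<open>f a\<close> involved are told apart.\<close>

definition box :: "nat \<times> (nat \<times> 'a \<times> bool) list \<Rightarrow> (nat \<Rightarrow> 'a \<Rightarrow> real) set" where
  "box = (\<lambda>(m, xs). {x \<in> topspace Z. \<forall>(i, a, b)\<in>set xs. x i a = of_bool b})"

lemma in_box_iff:
  "x \<in> box (m, xs) \<longleftrightarrow> x \<in> topspace Z \<and> (\<forall>i a b. (i, a, b) \<in> set xs \<longrightarrow> x i a = of_bool b)"
  unfolding box_def by auto

section \<open>Separated conditions and their patterns\<close>

text \<open>One level serves all factors and both truth values, so a segment identifies its
  coordinate throughout the list. Positivity of \<open>m\<close> keeps the label
  \<open>f a 0\<close> in the segment, as \<open>thin_Un\<close> requires.\<close>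

definition separated :: "nat \<Rightarrow> (nat \<times> 'a \<times> bool) list \<Rightarrow> bool" where
  "separated m xs \<longleftrightarrow> m > 0 \<and> (\<forall>i a b. (i, a, b) \<in> set xs \<longrightarrow> a \<in> F) \<and>
     (\<forall>i a b i' a' b'. (i, a, b) \<in> set xs \<longrightarrow> (i', a', b') \<in> set xs \<longrightarrow>
        (\<forall>k<m. f a k = f a' k) \<longrightarrow> a = a')"

lemma separatedD:
  assumes "separated m xs" "(i, a, b) \<in> set xs" "(i', a', b') \<in> set xs" "\<forall>k<m. f a k = f a' k"
  shows "a = a'"
  using assms unfolding separated_def by meson

definition boxes :: "(nat \<times> (nat \<times> 'a \<times> bool) list) set" where
  "boxes = {(m, xs). separated m xs \<and> box (m, xs) \<noteq> {}}"

text \<open>Replacing a coordinate by its segment is what makes the count small: \<open>F\<close>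
  has more than \<kappa> elements, but there are at most \<kappa> finite sequences in
  \<open>Field r\<close>.\<close>

definition pattern :: "nat \<times> (nat \<times> 'a \<times> bool) list \<Rightarrow> nat \<times> (nat \<times> 'k list \<times> bool) list" where
  "pattern = (\<lambda>(m, xs). (m, map (\<lambda>(i, a, b). (i, map (f a) [0..<m], b)) xs))"

lemma card_patterns: "|pattern ` boxes| \<le>o r"
proof -
  have "|Field r| \<le>o r" using card card_of_Field_ordIso ordIso_iff_ordLeq by blast
  then have "|(UNIV :: nat set) \<times> lists ((UNIV :: nat set) \<times> lists (Field r) \<times> (UNIV :: bool set))| \<le>o r"
    using countable_le[of "UNIV :: bool set"] nat_le
    by (intro card_of_Times_ordLeq_infinite_Field lists_ordLeq_infinite_Field card inf) auto
  moreover have "pattern ` boxes \<subseteq> UNIV \<times> lists (UNIV \<times> lists (Field r) \<times> UNIV)"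
    unfolding pattern_def boxes_def separated_def using entries by fastforce
  ultimately show ?thesis by (meson card_of_mono1 ordLeq_transitive)
qed

section \<open>The boxes form a linked \<pi>-base\<close>

lemma openin_box: "openin Z (box (m, xs))"
proof (induction xs)
  case Nil
  have "box (m, []) = topspace Z" by (auto simp: in_box_iff)
  then show ?case by simp
next
  case (Cons p xs)
  obtain i a b where p: "p = (i, a, b)" by (cases p)
  \<comment> \<open>Only the values 0 and 1 occur, so taking one of them means avoiding the other,
    which is an open condition.\<close>
  have "x i a = of_bool b \<longleftrightarrow> x i a \<in> - {of_bool (\<not> b)}" if "x \<in> topspace Z" for x
    using Z_value[OF that, of i a] by (cases b) auto
  then have "box (m, p # xs) = box (m, xs) \<inter> {x \<in> topspace Z. x i a \<in> - {of_bool (\<not> b)}}"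
    unfolding p box_def by auto
  moreover have "openin Z {x \<in> topspace Z. x i a \<in> - {of_bool (\<not> b)}}"
    by (rule openin_coordinate) auto
  ultimately show ?case using Cons.IH by (simp only: openin_Int)
qed

lemma openin_X_agreement:
  assumes "openin X V" "x \<in> V"
  shows "\<exists>A\<subseteq>F. finite A \<and> (\<forall>y\<in>K. (\<forall>a\<in>A. y a = x a) \<longrightarrow> y \<in> V)"
proof -
  obtain T where T: "open T" "V = K \<inter> T" using assms(1) unfolding openin_open by blast
  then obtain A where A: "finite A" "\<And>y. \<forall>a\<in>A. y a = x a \<Longrightarrow> y \<in> T"
    using open_fun_contains_finite_agreement assms(2) by blast
  \<comment> \<open>Coordinates outside \<open>F\<close> vanish on all of \<open>K\<close>, so
    agreement there is automatic.\<close>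
  have "y \<in> V" if "y \<in> K" "\<forall>a\<in>A \<inter> F. y a = x a" for y
  proof -
    have "x a = 0" "y a = 0" if "a \<notin> F" for a
      using that \<open>y \<in> K\<close> assms(2) T(2) by (auto simp: thin_indicators_def)
    then have "\<forall>a\<in>A. y a = x a"
      using that(2) by (metis IntI)
    then show ?thesis using A that T by auto
  qed
  then show ?thesis using A(1) by (intro exI[of _ "A \<inter> F"]) auto
qed

lemma openin_Z_agreement:
  assumes "openin Z V" "x \<in> V"
  shows "\<exists>C. C \<subseteq> UNIV \<times> F \<and> finite C \<and> (\<forall>y\<in>topspace Z. (\<forall>(i, a)\<in>C. y i a = x i a) \<longrightarrow> y \<in> V)"
proof -
  obtain U where U: "x \<in> (\<Pi>\<^sub>E i\<in>UNIV. U i)" "\<And>i. openin X (U i)"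
      "finite {i. U i \<noteq> topspace X}" "(\<Pi>\<^sub>E i\<in>UNIV. U i) \<subseteq> V"
    using product_topology_open_contains_basis[of "\<lambda>_. X" UNIV V x] assms
    unfolding countable_power_def by auto
  have "\<exists>A\<subseteq>F. finite A \<and> (\<forall>y\<in>K. (\<forall>a\<in>A. y a = x i a) \<longrightarrow> y \<in> U i)" for i
    by (rule openin_X_agreement[OF U(2)]) (use U(1) in auto)
  then obtain A where A: "\<And>i. A i \<subseteq> F" "\<And>i. finite (A i)"
      "\<And>i y. y \<in> K \<Longrightarrow> \<forall>a\<in>A i. y a = x i a \<Longrightarrow> y \<in> U i"
    by metis
  let ?C = "SIGMA i : {i. U i \<noteq> topspace X}. A i"
  have "y \<in> V" if "y \<in> topspace Z" "\<forall>(i, a)\<in>?C. y i a = x i a" for y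
  proof -
    have "y i \<in> U i" for i
      using that A(3)[of "y i" i] unfolding topspace_Z by (cases "U i = topspace X") auto
    then show ?thesis using U(4) by auto
  qed
  moreover have "?C \<subseteq> UNIV \<times> F" "finite ?C" using A U(3) by auto
  ultimately show ?thesis by blast
qed

text \<open>Membership in \<open>V\<close> near a point \<open>x\<close> of \<open>V\<close> is
  decided by finitely many values of \<open>x\<close>. Prescribe these values; injectivity of
  \<open>f\<close> on \<open>F\<close> yields a separating level, and \<open>x\<close> itself shows
  the box to be non-empty.\<close>

lemma boxes_pi_base:
  assumes "openin Z V" "V \<noteq> {}"
  shows "\<exists>p\<in>boxes. box p \<subseteq> V"
proof -
  obtain x where x: "x \<in> V" using assms(2) by blast
  obtain C where C: "C \<subseteq> UNIV \<times> F" "finite C"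
      "\<forall>y\<in>topspace Z. (\<forall>(i, a)\<in>C. y i a = x i a) \<longrightarrow> y \<in> V"
    using openin_Z_agreement[OF assms(1) x] by (elim exE conjE)
  obtain cs where cs: "set cs = C" using C(2) finite_list by blast
  define xs where "xs = map (\<lambda>(i, a). (i, a, x i a = 1)) cs"
  have "snd ` C \<subseteq> F" using C(1) by auto
  then have "inj_on f (snd ` C)" using inj inj_on_subset by blast
  then obtain m where m: "m > 0" "\<forall>a\<in>snd ` C. \<forall>b\<in>snd ` C. (\<forall>k<m. f a k = f b k) \<longrightarrow> a = b"
    using finite_separating_level[of "snd ` C" f] C(2) by auto
  have xZ: "x \<in> topspace Z" using x assms(1) openin_subset by blast
  have mem: "a \<in> snd ` C" if "(i, a, b) \<in> set xs" for i a b
    using that cs unfolding xs_def by (auto intro: image_eqI[of _ _ "(i, a)"])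
  have sep: "separated m xs"
    unfolding separated_def
  proof (intro conjI allI impI)
    show "a = a'" if "(i, a, b) \<in> set xs" "(i', a', b') \<in> set xs" "\<forall>k<m. f a k = f a' k"
      for i a b i' a' b'
      using m(2) mem[OF that(1)] mem[OF that(2)] that(3) by blast
  qed (use m(1) mem \<open>snd ` C \<subseteq> F\<close> in blast)+
  have xs: "(i, a, b) \<in> set xs \<longleftrightarrow> (i, a) \<in> C \<and> b = (x i a = 1)" for i a b
    using cs unfolding xs_def by auto
  have val: "of_bool (x i a = 1) = x i a" for i a
    using Z_value[OF xZ, of i a] by auto
  have "x \<in> box (m, xs)"
    by (simp add: in_box_iff xs xZ val)
  moreover have "box (m, xs) \<subseteq> V"
  proof
    fix y assume "y \<in> box (m, xs)"
    then have "y \<in> topspace Z" "\<forall>(i, a)\<in>C. y i a = x i a"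
      by (simp_all add: in_box_iff xs val split_beta)
    then show "y \<in> V" using C(3) by blast
  qed
  ultimately show ?thesis using sep unfolding boxes_def by blast
qed

lemma pattern_counterpart:
  assumes "pattern (m, xs) = pattern (n, ys)" "(i, a, b) \<in> set xs"
  shows "\<exists>a'. (i, a', b) \<in> set ys \<and> (\<forall>k<m. f a k = f a' k)"
proof -
  have mn: "n = m" using assms(1) unfolding pattern_def by simp
  have "(i, map (f a) [0..<m], b) \<in> set (map (\<lambda>(i, a, b). (i, map (f a) [0..<m], b)) xs)"
    using assms(2) by force
  also have "\<dots> = set (map (\<lambda>(i, a, b). (i, map (f a) [0..<m], b)) ys)"
    using assms(1) mn unfolding pattern_def by simp
  finally show ?thesis by auto
qed

text \<open>The common point has in factor \<open>i\<close> the indicator of all coordinates to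
  which either list assigns \<open>True\<close>. The two sets of such coordinates lie in supports of
  points of the boxes, hence are thin, and have the same separated segments, so
  \<open>thin_Un\<close> applies. Prescribed zeros survive by \<open>no_clash\<close>.\<close>

lemma boxes_linked:
  assumes "p \<in> boxes" "q \<in> boxes" "pattern p = pattern q"
  shows "box p \<inter> box q \<noteq> {}"
proof -
  obtain m xs n ys where pq: "p = (m, xs)" "q = (n, ys)" by fastforce
  have mn: "n = m" using assms(3) pq unfolding pattern_def by simp
  have pat: "pattern (m, xs) = pattern (m, ys)" using assms(3) pq mn by simp
  have sep: "separated m xs" "separated m ys" using assms pq mn unfolding boxes_def by auto
  obtain x y where xy: "x \<in> box (m, xs)" "y \<in> box (m, ys)"
    using assms pq mn unfolding boxes_def by auto
  define P where "P zs i = {a. (i, a, True) \<in> set zs}" for zs :: "(nat \<times> 'a \<times> bool) list" and i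
  define z :: "nat \<Rightarrow> 'a \<Rightarrow> real"
    where "z i = (\<lambda>a. if a \<in> P xs i \<union> P ys i then 1 else 0)" for i
  have thin: "thin f (P zs i)" if "w \<in> box (m, zs)" for zs w i
  proof -
    have "w i \<in> K" using that unfolding box_def topspace_Z by auto
    moreover have "P zs i \<subseteq> {a. w i a \<noteq> 0}" using that unfolding in_box_iff P_def by force
    ultimately show ?thesis using thin_mono unfolding thin_indicators_def by blast
  qed
  have cp: "\<exists>b\<in>P vs i. \<forall>k<m. f a k = f b k"
    if "pattern (m, us) = pattern (m, vs)" "a \<in> P us i" for us vs a i
    using pattern_counterpart[OF that(1)] that(2) unfolding P_def by blast
  have sepP: "a = b" if "separated m us" "a \<in> P us i" "b \<in> P us i" "\<forall>k<m. f a k = f b k" for us a b i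
    using separatedD[OF that(1) _ _ that(4)] that(2,3) unfolding P_def by blast
  have "z i \<in> K" for i
    unfolding z_def
  proof (rule thin_indicators_of_set)
    have "P us i \<subseteq> F" if "separated m us" for us
      using that unfolding separated_def P_def by blast
    then show "P xs i \<union> P ys i \<subseteq> F" using sep by simp
    show "thin f (P xs i \<union> P ys i)"
    proof (rule thin_Un[OF thin[OF xy(1)] thin[OF xy(2)], of m])
      show "m > 0" using sep(1) unfolding separated_def by simp
    qed (fact cp[OF pat] cp[OF pat[symmetric]] sepP[OF sep(1)] sepP[OF sep(2)])+
  qed
  then have zZ: "z \<in> topspace Z" unfolding topspace_Z by simp
  \<comment> \<open>If \<open>vs\<close> assigned \<open>True\<close> to \<open>a\<close>, then
    \<open>us\<close> would do so for some \<open>b\<close> with the same segment. Separation gives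
    \<open>a = b\<close>, so \<open>us\<close> would prescribe both values at \<open>a\<close>,
    contradicting the point \<open>w\<close> of its box.\<close>
  have no_clash: "a \<notin> P us i \<union> P vs i"
    if F: "(i, a, False) \<in> set us" and w: "w \<in> box (m, us)" and us: "separated m us"
      and eq: "pattern (m, us) = pattern (m, vs)" for us vs w i a
  proof -
    have "w i a = of_bool b" if "(i, a, b) \<in> set us" for b
      using that w by (simp add: in_box_iff)
    from this[of True] this[of False] have own: "a \<notin> P us i"
      using F by (auto simp: P_def)
    moreover have "a \<notin> P vs i"
    proof
      assume "a \<in> P vs i"
      then obtain b where b: "b \<in> P us i" "\<forall>k<m. f a k = f b k"
        using cp[OF eq[symmetric]] by blast
      then have "a = b" using separatedD[OF us F _ b(2)] unfolding P_def by blast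
      then show False using b own by simp
    qed
    ultimately show ?thesis by simp
  qed
  have "z i a = of_bool b" if "(i, a, b) \<in> set xs" for i a b
    using no_clash[OF _ xy(1) sep(1) pat] that unfolding z_def by (cases b) (auto simp: P_def)
  moreover have "z i a = of_bool b" if "(i, a, b) \<in> set ys" for i a b
    using no_clash[OF _ xy(2) sep(2) pat[symmetric]] that unfolding z_def by (cases b) (auto simp: P_def)
  ultimately have "z \<in> box p \<inter> box q" using zZ pq mn by (simp add: in_box_iff)
  then show ?thesis by blast
qed

lemma linked: "linked_pi_base Z boxes box pattern"
  unfolding linked_pi_base_def
proof (intro conjI ballI allI impI)
  show "openin Z (box p)" "box p \<noteq> {}" if "p \<in> boxes" for p
    using that openin_box by (auto simp: boxes_def)
  show "\<exists>p\<in>boxes. box p \<subseteq> V" if "openin Z V \<and> V \<noteq> {}" for V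
    using that boxes_pi_base by simp
  show "box p \<inter> box q \<noteq> {}" if "p \<in> boxes" "q \<in> boxes" "pattern p = pattern q" for p q
    using that by (rule boxes_linked)
qed

section \<open>Cellularity and dense metrizable subspaces of the power\<close>

lemma cellularity: "cellularity_eq Z r"
  unfolding cellularity_eq_def
proof (intro conjI allI impI)
  fix U assume "cellular_family Z U"
  then show "|U| \<le>o r"
    using linked_pi_base_cellular_family[OF linked] card_patterns ordLeq_transitive by blast
next
  fix A assume "A \<subseteq> Field r"
  then show "\<exists>U. cellular_family Z U \<and> |A| \<le>o |U|"
    using cellular_lower by (meson card_of_mono1 ordLeq_transitive)
qed

text \<open>A dense metrizable subspace would yield a dense set of size at most \<kappa> in the
  power. Its projection to one factor would be dense in \<open>X\<close> and no larger, against
  \<open>dense_not_small\<close>.\<close>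

lemma no_metrizable_dense:
  "\<not> (\<exists>D. dense_in Z D \<and> metrizable_space (subtopology Z D))"
proof
  assume "\<exists>D. dense_in Z D \<and> metrizable_space (subtopology Z D)"
  then obtain E where E: "dense_in Z E" "|E| \<le>o r"
    using metrizable_dense_imp_small_dense[OF linked card inf card_patterns] by blast
  have proj: "continuous_map Z X (\<lambda>x. x 0)"
    unfolding countable_power_def by (rule continuous_map_product_projection) simp
  have "dense_in X ((\<lambda>x. x 0) ` E)"
    unfolding dense_in_iff
  proof (intro conjI allI impI)
    show "(\<lambda>x. x 0) ` E \<subseteq> topspace X"
      using E(1) unfolding dense_in_def topspace_Z by auto
    fix V assume V: "openin X V \<and> V \<noteq> {}"
    then obtain v where v: "v \<in> V" "v \<in> K" using openin_subset by fastforce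
    then have "(\<lambda>_. v) \<in> {x \<in> topspace Z. x 0 \<in> V}" unfolding topspace_Z by simp
    moreover have "openin Z {x \<in> topspace Z. x 0 \<in> V}"
      using openin_continuous_map_preimage[OF proj] V by blast
    ultimately have "E \<inter> {x \<in> topspace Z. x 0 \<in> V} \<noteq> {}"
      using E(1) unfolding dense_in_iff by blast
    then show "(\<lambda>x. x 0) ` E \<inter> V \<noteq> {}" by blast
  qed
  moreover have "|(\<lambda>x. x 0) ` E| \<le>o r"
    using E(2) card_of_image ordLeq_transitive by blast
  ultimately show False using dense_not_small by blast
qed

end

section \<open>Coding the given family by sequences\<close>

theorem mainTheorem8:
  fixes r :: "'k rel"
  assumes "singular_countable_cof r"
    and "\<exists>F. F \<subseteq> countable_subsets (Field r) \<and> locally_countable F \<and> r <o (card_of F)"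
  shows "\<exists>(X :: ('k set \<Rightarrow> real) topology) (L :: 'k set set).
           corson_compactum_in L X \<and>
           cellularity_eq (countable_power X) r \<and> density_gt X r \<and>
           \<not> (\<exists>D. dense_in (countable_power X) D \<and>
                 metrizable_space (subtopology (countable_power X) D))"
proof -
  obtain F where F: "F \<subseteq> countable_subsets (Field r)" "locally_countable F" "r <o |F|"
    using assms(2) by blast
  have card: "Card_order r" using assms(1) unfolding singular_countable_cof_def by blast
  have "F \<noteq> {}"
    using F(3) card card_of_empty1[of r] not_ordLess_ordLeq card_order_on_well_order_on by metis
  then have inf: "infinite (Field r)"
    using F(1) unfolding countable_subsets_def by (auto dest: finite_subset)
  have "|Field r| \<le>o |F|"
    using F(3) card by (meson card_of_Field_ordIso ordIso_ordLeq_trans ordLess_imp_ordLeq)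
  then obtain g where g: "g ` F = Field r"
    using card_of_ordLeq2[of "Field r" F] inf by fastforce
  \<comment> \<open>The label \<open>g a\<close> is put in front of an enumeration of
    \<open>a\<close>. The tail recovers \<open>a\<close>, which gives injectivity, while
    surjectivity of \<open>g\<close> makes every element of \<open>Field r\<close> a label.\<close>
  define f where "f a n = (case n of 0 \<Rightarrow> g a | Suc k \<Rightarrow> from_nat_into a k)" for a n
  have f0: "f a 0 = g a" and fSuc: "f a (Suc k) = from_nat_into a k" for a k
    unfolding f_def by simp_all
  have a: "a \<subseteq> Field r \<and> range (from_nat_into a) = a" if "a \<in> F" for a
    using F(1) that range_from_nat_into[of a] unfolding countable_subsets_def by fastforce
  have ran: "range (\<lambda>k. f a (Suc k)) = a" if "a \<in> F" for a
    using a[OF that] fSuc by simp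
  interpret coded_family r F f
  proof
    show "Card_order r" "infinite (Field r)" "r <o |F|" by fact+
    show "inj_on f F" using ran by (metis inj_onI)
    show "countable A" if "A \<subseteq> F" "countable (\<Union>a\<in>A. range (f a))" for A
    proof -
      \<comment> \<open>Only an inclusion holds in general, since the label \<open>g a\<close> may
        lie outside \<open>a\<close>; it suffices to pass countability down to the union of
        \<open>A\<close>.\<close>
      have "a \<subseteq> range (f a)" if "a \<in> F" for a
        using ran[OF that] by blast
      then have "\<Union>A \<subseteq> (\<Union>a\<in>A. range (f a))" using that(1) by blast
      then have "countable (\<Union>A)" by (rule countable_subset[OF _ that(2)])
      then show ?thesis using F(2) that(1) unfolding locally_countable_def by blast
    qed
    show "f b n \<in> Field r" if "b \<in> F" for b n
    proof (cases n)
      case 0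
      then show ?thesis using f0 g that by auto
    next
      case (Suc k)
      then show ?thesis using ran[OF that] a[OF that] by blast
    qed
    show "(\<lambda>a. f a 0) ` F = Field r" using f0 g by simp
  qed
  show ?thesis using corson cellularity density no_metrizable_dense by blast
qed

end
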